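(* Let $X$ and $Y$ be finite dimensional complex Hilbert spaces, let $\Gamma$ be a discrete abelian group, and let $\mathcal{G}=(G,\varphi,\theta,\tau)$ be a $\Gamma$-symmetric framework for $X$ and $Y$ with symbol function $\Phi\in L^\infty(\hat\Gamma,B(X^{V_0},Y^{E_0}))$. Then \[\Phi(\chi)=O_{\mathcal{G}}(\chi)\quad\text{for a.e. }\chi\in\hat\Gamma,\] where $O_{\mathcal{G}}(\chi)$ is the $\chi$-orbit matrix of $\mathcal{G}$.
   Context: Frameworks. A framework for $X$ and $Y$ is a pair $(G,\varphi)$ with $G=(V,E)$ a simple undirected graph and $\varphi=(\varphi_{v,w})_{v,w\in V}$ a family of linear maps $\varphi_{v,w}:X\to Y$ with $\varphi_{v,w}=0$ if $vw\notin E$ and $\varphi_{v,w}=-\varphi_{w,v}$ if $vw\in E$. Throughout $V$ is finite or countably infinite. The coboundary matrix $C(G,\varphi)$ has rows indexed by $E$, columns indexed by $V$; in row $vw$ the $v$-entry is $\varphi_{v,w}$, the $w$-entry is $\varphi_{w,v}$, and other entries are $0$. It defines the linear map $C(G,\varphi):X^V\to Y^E$, $(x_v)_{v\in V}\mapsto(\varphi_{v,w}(x_v-x_w))_{vw\in E}$. Symmetry. $\Gamma$ is written additively with identity $0$. $\theta:\Gamma\to\mathrm{Aut}(G)$ is a homomorphism; write $\gamma v=\theta(\gamma)v$ and $\gamma e=(\gamma v)(\gamma w)$ for $e=vw$ (in particular $-\gamma v=\theta(-\gamma)v$). Standing assumptions: $\theta$ acts freely on vertices and edges ($\gamma v\ne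 v$, $\gamma e\neq e$ for all $\gamma\ne0$, $v\in V$, $e\in E$), and the sets $V_0$ of vertex orbits $[v]$ and $E_0$ of edge orbits $[e]$ are finite. $\tau:\Gamma\to\mathrm{Isom}(X)$ is a homomorphism into the group of affine isometries of $X$, with $d\tau(\gamma)$ the linear part of $\tau(\gamma)$. $(G,\varphi,\theta,\tau)$ is a $\Gamma$-symmetric framework if $\varphi_{\gamma v,\gamma w}=\varphi_{v,w}\circ d\tau(-\gamma)$ for all $\gamma\in\Gamma$, $v,w\in V$. Gain graph. Choose a representative $\tilde v\in[v]$ for each $[v]\in V_0$. The quotient multigraph has vertex set $V_0$ and edge set $E_0$, $[e]$ joining $[v]$ and $[w]$ if edges in $[e]$ join a vertex of $[v]$ to one of $[w]$; fix an orientation $[e]=([v],[w])$ of each edge. The gain of $[e]=([v],[w])$ is the $\gamma\in\Gamma$ with $\tilde v(\gamma\tilde w)\in[e]$ (for a loop, $[v]=[w]$, this determines $\gamma$ up to sign and one choice is fixed). Put $\tilde e=\tilde v(\gamma\tilde w)\in E$. Every vertex is uniquely $\gamma\tilde v$ and every edge uniquely $\gamma\tilde e$. One gain graph is fixed throughout. Symbol function. $S_V:\ell^2(V,X)\to\ell^2(\Gamma,X^{V_0})$, $S_V(z)_\gamma=(z_{\gamma\tilde v})_{[v]}$, and $S_E:\ell^2(E,Y)\to\ell^2(\Gamma,Y^{E_0})$, $S_E(z)_\gamma=(z_{\gamma\tilde e})_{[e]}$, are unitary. $\tilde\tau(\gamma)(x_{[v]})_{[v]}=(d\tau(\gamma)x_{[v]})_{[v]}$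 on $X^{V_0}$, and $(T_{\tilde\tau}f)(\gamma)=\tilde\tau(-\gamma)f(\gamma)$. $\hat\Gamma$ is the compact dual group with Haar probability measure; $F_H:\ell^2(\Gamma,H)\to L^2(\hat\Gamma,H)$ is the unitary Fourier transform, $\hat f(\chi)=\sum_\gamma\overline{\chi(\gamma)}f(\gamma)$ for $f\in\ell^1(\Gamma,H)$. $(M_\Phi f)(\chi)=\Phi(\chi)f(\chi)$. The symbol function of $\mathcal G$ is the element $\Phi\in L^\infty(\hat\Gamma,B(X^{V_0},Y^{E_0}))$ satisfying $C(G,\varphi)=S_E^{-1}F_{Y^{E_0}}^{-1}M_\Phi F_{X^{V_0}}T_{\tilde\tau}S_V$ as bounded operators $\ell^2(V,X)\to\ell^2(E,Y)$. Orbit matrix. For $\chi\in\hat\Gamma$, $O_{\mathcal G}(\chi):X^{V_0}\to Y^{E_0}$ is given by the matrix with rows indexed by $E_0$ and columns by $V_0$ as follows. In the row of a non-loop directed edge $([v],[w])$ with gain $\gamma$: the $[v]$-entry is $\varphi_{\tilde v,\gamma\tilde w}$, the $[w]$-entry is $\chi(\gamma)\varphi_{\tilde w,-\gamma\tilde v}$, all others $0$. In the row of a loop $([v],[v])$ with gain $\gamma$: the $[v]$-entry is $\varphi_{\tilde v,\gamma\tilde v}+\chi(\gamma)\varphi_{\tilde v,-\gamma\tilde v}$, all others $0$. *)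

theory Defs
  imports "HOL-Analysis.Analysis"
begin

section \<open>Finite dimensional complex Hilbert spaces\<close>

text \<open>
  The real structure (norm, topology) is the one of \<^class>\<open>real_inner\<close>; the real inner product is
  the real part of the complex one. The last axiom is finite dimensionality over the complex
  numbers, so completeness is automatic. The zero space is admitted.
\<close>

class fd_complex_hilbert = real_inner +
  fixes scaleC :: "complex \<Rightarrow> 'a \<Rightarrow> 'a" (infixr "*\<^sub>C" 75)
    and cinner :: "'a \<Rightarrow> 'a \<Rightarrow> complex"
  assumes scaleC_add_right: "a *\<^sub>C (x + y) = a *\<^sub>C x + a *\<^sub>C y"
    and scaleC_add_left: "(a + b) *\<^sub>C x = a *\<^sub>C x + b *\<^sub>C x"
    and scaleC_scaleC: "a *\<^sub>C b *\<^sub>C x = (a * b) *\<^sub>C x"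
    and scaleR_scaleC: "r *\<^sub>R x = complex_of_real r *\<^sub>C x"
    and cinner_commute: "cinner x y = cnj (cinner y x)"
    and cinner_add_right: "cinner x (y + z) = cinner x y + cinner x z"
    and cinner_scaleC_right: "cinner x (a *\<^sub>C y) = a * cinner x y"
    and inner_eq_Re_cinner: "inner x y = Re (cinner x y)"
    and finite_dimensional: "\<exists>B. finite B \<and> (\<forall>x. \<exists>c. x = (\<Sum>b\<in>B. c b *\<^sub>C b))"

definition complex_linear :: "('x::fd_complex_hilbert \<Rightarrow> 'y::fd_complex_hilbert) \<Rightarrow> bool" where
  "complex_linear f \<longleftrightarrow> (\<forall>x y. f (x + y) = f x + f y) \<and> (\<forall>a x. f (a *\<^sub>C x) = a *\<^sub>C f x)"

definition linear_part :: "('x::fd_complex_hilbert \<Rightarrow> 'x) \<Rightarrow> 'x \<Rightarrow> 'x" where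
  "linear_part T x = T x - T 0"

definition affine_isometry :: "('x::fd_complex_hilbert \<Rightarrow> 'x) \<Rightarrow> bool" where
  "affine_isometry T \<longleftrightarrow>
     bij T \<and> complex_linear (linear_part T) \<and> (\<forall>x y. dist (T x) (T y) = dist x y)"


section \<open>Symmetric frameworks\<close>

text \<open>
  Vertices form a subset of a type, edges are two-element sets of vertices, and a graph
  automorphism acts on an edge by taking images.
\<close>

definition simple_graph :: "'v set \<Rightarrow> 'v set set \<Rightarrow> bool" where
  "simple_graph V E \<longleftrightarrow> (\<forall>e\<in>E. e \<subseteq> V \<and> card e = 2)"

definition framework ::
  "'v set \<Rightarrow> 'v set set \<Rightarrow> ('v \<Rightarrow> 'v \<Rightarrow> 'x::fd_complex_hilbert \<Rightarrow> 'y::fd_complex_hilbert) \<Rightarrow> bool" where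
  "framework V E \<phi> \<longleftrightarrow> simple_graph V E \<and> countable V \<and>
     (\<forall>v\<in>V. \<forall>w\<in>V. complex_linear (\<phi> v w) \<and>
        ({v, w} \<notin> E \<longrightarrow> \<phi> v w = (\<lambda>x. 0)) \<and>
        ({v, w} \<in> E \<longrightarrow> \<phi> v w = (\<lambda>x. - \<phi> w v x)))"

definition graph_action ::
  "'v set \<Rightarrow> 'v set set \<Rightarrow> ('g::ab_group_add \<Rightarrow> 'v \<Rightarrow> 'v) \<Rightarrow> bool" where
  "graph_action V E \<theta> \<longleftrightarrow>
     (\<forall>\<gamma>. bij_betw (\<theta> \<gamma>) V V \<and> (\<forall>v\<in>V. \<forall>w\<in>V. {\<theta> \<gamma> v, \<theta> \<gamma> w} \<in> E \<longleftrightarrow> {v, w} \<in> E)) \<and>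
     (\<forall>\<gamma> \<delta>. \<forall>v\<in>V. \<theta> (\<gamma> + \<delta>) v = \<theta> \<gamma> (\<theta> \<delta> v))"

definition vertex_orbit :: "('g::ab_group_add \<Rightarrow> 'v \<Rightarrow> 'v) \<Rightarrow> 'v \<Rightarrow> 'v set" where
  "vertex_orbit \<theta> v = range (\<lambda>\<gamma>. \<theta> \<gamma> v)"

definition edge_orbit :: "('g::ab_group_add \<Rightarrow> 'v \<Rightarrow> 'v) \<Rightarrow> 'v set \<Rightarrow> 'v set set" where
  "edge_orbit \<theta> e = range (\<lambda>\<gamma>. \<theta> \<gamma> ` e)"

definition vertex_orbits :: "'v set \<Rightarrow> ('g::ab_group_add \<Rightarrow> 'v \<Rightarrow> 'v) \<Rightarrow> 'v set set" where
  "vertex_orbits V \<theta> = vertex_orbit \<theta> ` V"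

definition edge_orbits :: "'v set set \<Rightarrow> ('g::ab_group_add \<Rightarrow> 'v \<Rightarrow> 'v) \<Rightarrow> 'v set set set" where
  "edge_orbits E \<theta> = edge_orbit \<theta> ` E"

definition symmetric_framework ::
  "'v set \<Rightarrow> 'v set set \<Rightarrow> ('v \<Rightarrow> 'v \<Rightarrow> 'x::fd_complex_hilbert \<Rightarrow> 'y::fd_complex_hilbert) \<Rightarrow>
   ('g::ab_group_add \<Rightarrow> 'v \<Rightarrow> 'v) \<Rightarrow> ('g \<Rightarrow> 'x \<Rightarrow> 'x) \<Rightarrow> bool" where
  "symmetric_framework V E \<phi> \<theta> \<tau> \<longleftrightarrow>
     framework V E \<phi> \<and>
     graph_action V E \<theta> \<and>
     (\<forall>\<gamma>. \<gamma> \<noteq> 0 \<longrightarrow> (\<forall>v\<in>V. \<theta> \<gamma> v \<noteq> v) \<and> (\<forall>e\<in>E. \<theta> \<gamma> ` e \<noteq> e)) \<and>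
     finite (vertex_orbits V \<theta>) \<and> finite (edge_orbits E \<theta>) \<and>
     (\<forall>\<gamma>. affine_isometry (\<tau> \<gamma>)) \<and> (\<forall>\<gamma> \<delta>. \<tau> (\<gamma> + \<delta>) = \<tau> \<gamma> \<circ> \<tau> \<delta>) \<and>
     (\<forall>\<gamma>. \<forall>v\<in>V. \<forall>w\<in>V. \<phi> (\<theta> \<gamma> v) (\<theta> \<gamma> w) = \<phi> v w \<circ> linear_part (\<tau> (- \<gamma>)))"

text \<open>
  Row \<open>e\<close> of the coboundary matrix: for \<open>e = {u, w}\<close> the \<open>u\<close>-entry is \<open>\<phi> u w\<close>. Only the columns
  \<open>u \<in> e\<close> contribute to a row, so the row sum runs over \<open>e\<close>.
\<close>

definition coboundary_entry ::
  "('v \<Rightarrow> 'v \<Rightarrow> 'x::fd_complex_hilbert \<Rightarrow> 'y::fd_complex_hilbert) \<Rightarrow> 'v set \<Rightarrow> 'v \<Rightarrow> 'x \<Rightarrow> 'y" where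
  "coboundary_entry \<phi> e u = (if u \<in> e then \<phi> u (the_elem (e - {u})) else (\<lambda>x. 0))"

definition coboundary ::
  "'v set set \<Rightarrow> ('v \<Rightarrow> 'v \<Rightarrow> 'x::fd_complex_hilbert \<Rightarrow> 'y::fd_complex_hilbert) \<Rightarrow>
   ('v \<Rightarrow> 'x) \<Rightarrow> 'v set \<Rightarrow> 'y" where
  "coboundary E \<phi> x = (\<lambda>e. if e \<in> E then (\<Sum>u\<in>e. coboundary_entry \<phi> e u (x u)) else 0)"


section \<open>Gain graphs\<close>

text \<open>
  A gain graph consists of the chosen vertex representatives together with, for each edge orbit
  \<open>[e] = ([v], [w])\<close>, its tail \<open>[v]\<close>, its head \<open>[w]\<close> and its gain. The last condition of
  \<open>is_gain_graph\<close> says both that \<open>[e]\<close> joins \<open>[v]\<close> and \<open>[w]\<close> and that the gain is correct; the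
  orientation, and the sign of the gain of a loop, remain arbitrary choices.
\<close>

record ('v, 'g) gain_graph =
  rep :: "'v set \<Rightarrow> 'v"
  tail :: "'v set set \<Rightarrow> 'v set"
  head :: "'v set set \<Rightarrow> 'v set"
  gain :: "'v set set \<Rightarrow> 'g"

definition edge_rep ::
  "('g::ab_group_add \<Rightarrow> 'v \<Rightarrow> 'v) \<Rightarrow> ('v, 'g) gain_graph \<Rightarrow> 'v set set \<Rightarrow> 'v set" where
  "edge_rep \<theta> Q c = {rep Q (tail Q c), \<theta> (gain Q c) (rep Q (head Q c))}"

definition is_gain_graph ::
  "'v set \<Rightarrow> 'v set set \<Rightarrow> ('g::ab_group_add \<Rightarrow> 'v \<Rightarrow> 'v) \<Rightarrow> ('v, 'g) gain_graph \<Rightarrow> bool" where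
  "is_gain_graph V E \<theta> Q \<longleftrightarrow>
     (\<forall>a\<in>vertex_orbits V \<theta>. rep Q a \<in> a) \<and>
     (\<forall>c\<in>edge_orbits E \<theta>.
        tail Q c \<in> vertex_orbits V \<theta> \<and> head Q c \<in> vertex_orbits V \<theta> \<and> edge_rep \<theta> Q c \<in> c)"


section \<open>Function spaces\<close>

text \<open>
  The elements of \<open>X\<^sup>I\<close> are the functions that vanish outside \<open>I\<close>. Elements of \<open>L\<^sup>2\<close> and \<open>L\<^sup>\<infinity>\<close> are
  represented by functions, without passing to classes modulo null sets.
\<close>

definition vecs :: "'i set \<Rightarrow> ('i \<Rightarrow> 'x::zero) set" where
  "vecs I = {x. \<forall>i. i \<notin> I \<longrightarrow> x i = 0}"

definition norm_sq :: "'i set \<Rightarrow> ('i \<Rightarrow> 'x::real_normed_vector) \<Rightarrow> real" where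
  "norm_sq I x = (\<Sum>i\<in>I. (norm (x i))\<^sup>2)"

definition ell2 :: "'a set \<Rightarrow> ('a \<Rightarrow> 'x::real_normed_vector) set" where
  "ell2 A = {z \<in> vecs A. (\<lambda>a. (norm (z a))\<^sup>2) summable_on A}"

definition ell2_vecs :: "'i set \<Rightarrow> ('g \<Rightarrow> 'i \<Rightarrow> 'x::real_normed_vector) set" where
  "ell2_vecs I = {f. (\<forall>\<gamma>. f \<gamma> \<in> vecs I) \<and> (\<lambda>\<gamma>. norm_sq I (f \<gamma>)) summable_on UNIV}"

text \<open>
  The dual group of a discrete group carries the topology of pointwise convergence, i.e. the
  subspace topology of the product topology on the function type.
\<close>

definition dual_group :: "('g::ab_group_add \<Rightarrow> complex) set" where
  "dual_group = {\<xi>. (\<forall>\<gamma>. cmod (\<xi> \<gamma>) = 1) \<and> (\<forall>\<gamma> \<delta>. \<xi> (\<gamma> + \<delta>) = \<xi> \<gamma> * \<xi> \<delta>)}"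

definition haar_prob_measure :: "('g::ab_group_add \<Rightarrow> complex) measure \<Rightarrow> bool" where
  "haar_prob_measure \<mu> \<longleftrightarrow>
     sets \<mu> = sets (restrict_space borel dual_group) \<and>
     emeasure \<mu> (space \<mu>) = 1 \<and>
     (\<forall>A\<in>sets \<mu>. emeasure \<mu> A = (SUP K\<in>{K. K \<subseteq> A \<and> compact K}. emeasure \<mu> K)) \<and>
     (\<forall>\<psi>\<in>dual_group. \<forall>A\<in>sets \<mu>. emeasure \<mu> ((\<lambda>\<xi> \<gamma>. \<psi> \<gamma> * \<xi> \<gamma>) ` A) = emeasure \<mu> A)"

definition L2_vecs ::
  "('g::ab_group_add \<Rightarrow> complex) measure \<Rightarrow> 'i set \<Rightarrow>
   (('g \<Rightarrow> complex) \<Rightarrow> 'i \<Rightarrow> 'x::real_normed_vector) set" where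
  "L2_vecs \<mu> I = {h. (\<forall>\<xi>\<in>dual_group. h \<xi> \<in> vecs I) \<and>
     (\<forall>i\<in>I. (\<lambda>\<xi>. h \<xi> i) \<in> borel_measurable \<mu>) \<and>
     (\<integral>\<^sup>+ \<xi>. ennreal (norm_sq I (h \<xi>)) \<partial>\<mu>) < \<infinity>}"

text \<open>
  For finite \<open>I\<close> and \<open>J\<close>, a map into \<open>B(X\<^sup>I, Y\<^sup>J)\<close> is measurable iff all its matrix coefficient maps
  are.
\<close>

definition Linf_ops ::
  "('g::ab_group_add \<Rightarrow> complex) measure \<Rightarrow> 'i set \<Rightarrow> 'j set \<Rightarrow>
   (('g \<Rightarrow> complex) \<Rightarrow> ('i \<Rightarrow> 'x::fd_complex_hilbert) \<Rightarrow> 'j \<Rightarrow> 'y::fd_complex_hilbert) set" where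
  "Linf_ops \<mu> I J = {\<Phi>.
     (\<forall>\<xi>\<in>dual_group. \<forall>x\<in>vecs I.
        \<Phi> \<xi> x \<in> vecs J \<and>
        (\<forall>y\<in>vecs I. \<Phi> \<xi> (\<lambda>i. x i + y i) = (\<lambda>j. \<Phi> \<xi> x j + \<Phi> \<xi> y j)) \<and>
        (\<forall>a. \<Phi> \<xi> (\<lambda>i. a *\<^sub>C x i) = (\<lambda>j. a *\<^sub>C \<Phi> \<xi> x j))) \<and>
     (\<forall>x\<in>vecs I. \<forall>j\<in>J. (\<lambda>\<xi>. \<Phi> \<xi> x j) \<in> borel_measurable \<mu>) \<and>
     (\<exists>M. AE \<xi> in \<mu>. \<forall>x\<in>vecs I. sqrt (norm_sq J (\<Phi> \<xi> x)) \<le> M * sqrt (norm_sq I x))}"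


section \<open>The symbol function\<close>

text \<open>
  Operators are given by their graphs, so that an inverse is the converse relation and the inverse
  of an operator with values in \<open>L\<^sup>2\<close> needs no choice of representatives.
\<close>

definition graph_on :: "'a set \<Rightarrow> ('a \<Rightarrow> 'b) \<Rightarrow> ('a \<times> 'b) set" where
  "graph_on A f = {(a, f a) | a. a \<in> A}"

text \<open>
  The unitary Fourier transform: \<open>(f, h)\<close> belongs to the relation iff the finite partial sums of
  \<open>\<Sum>\<^sub>\<gamma> cnj (\<xi> \<gamma>) f(\<gamma>)\<close> converge to \<open>h\<close> in \<open>L\<^sup>2\<close>. Since the finitely supported functions
  are dense, this is the unique continuous extension of the transform of absolutely summable
  functions; \<open>h\<close> ranges over all representatives of its class.
\<close>

definition fourier ::
  "('g::ab_group_add \<Rightarrow> complex) measure \<Rightarrow> 'i set \<Rightarrow>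
   (('g \<Rightarrow> 'i \<Rightarrow> 'x::fd_complex_hilbert) \<times> (('g \<Rightarrow> complex) \<Rightarrow> 'i \<Rightarrow> 'x)) set" where
  "fourier \<mu> I = {(f, h). f \<in> ell2_vecs I \<and> h \<in> L2_vecs \<mu> I \<and>
     ((\<lambda>S. \<integral>\<^sup>+ \<xi>. ennreal (norm_sq I (\<lambda>i. h \<xi> i - (\<Sum>\<gamma>\<in>S. cnj (\<xi> \<gamma>) *\<^sub>C f \<gamma> i))) \<partial>\<mu>)
        \<longlongrightarrow> 0) (finite_subsets_at_top UNIV)}"

definition S_V ::
  "'v set \<Rightarrow> ('g::ab_group_add \<Rightarrow> 'v \<Rightarrow> 'v) \<Rightarrow> ('v, 'g) gain_graph \<Rightarrow>
   ('v \<Rightarrow> 'x::fd_complex_hilbert) \<Rightarrow> 'g \<Rightarrow> 'v set \<Rightarrow> 'x" where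
  "S_V V \<theta> Q z = (\<lambda>\<gamma> a. if a \<in> vertex_orbits V \<theta> then z (\<theta> \<gamma> (rep Q a)) else 0)"

definition S_E ::
  "'v set set \<Rightarrow> ('g::ab_group_add \<Rightarrow> 'v \<Rightarrow> 'v) \<Rightarrow> ('v, 'g) gain_graph \<Rightarrow>
   ('v set \<Rightarrow> 'y::fd_complex_hilbert) \<Rightarrow> 'g \<Rightarrow> 'v set set \<Rightarrow> 'y" where
  "S_E E \<theta> Q z = (\<lambda>\<gamma> c. if c \<in> edge_orbits E \<theta> then z (\<theta> \<gamma> ` edge_rep \<theta> Q c) else 0)"

definition twist ::
  "('g::ab_group_add \<Rightarrow> 'x \<Rightarrow> 'x) \<Rightarrow> ('g \<Rightarrow> 'i \<Rightarrow> 'x::fd_complex_hilbert) \<Rightarrow> 'g \<Rightarrow> 'i \<Rightarrow> 'x" where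
  "twist \<tau> f = (\<lambda>\<gamma> i. linear_part (\<tau> (- \<gamma>)) (f \<gamma> i))"

definition multiplication ::
  "(('g \<Rightarrow> complex) \<Rightarrow> ('i \<Rightarrow> 'x) \<Rightarrow> 'j \<Rightarrow> 'y) \<Rightarrow>
   (('g \<Rightarrow> complex) \<Rightarrow> 'i \<Rightarrow> 'x) \<Rightarrow> ('g \<Rightarrow> complex) \<Rightarrow> 'j \<Rightarrow> 'y" where
  "multiplication \<Phi> h = (\<lambda>\<xi>. \<Phi> \<xi> (h \<xi>))"

text \<open>
  \<open>R O S\<close> applies \<open>R\<close> first. The factorization thus reads, from left to right,
  \<open>S\<^sub>V\<close>, the twist, the Fourier transform, multiplication by the symbol, the inverse Fourier transform
  and the inverse of \<open>S\<^sub>E\<close>.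
\<close>

definition is_symbol_function ::
  "('g::ab_group_add \<Rightarrow> complex) measure \<Rightarrow> 'v set \<Rightarrow> 'v set set \<Rightarrow>
   ('v \<Rightarrow> 'v \<Rightarrow> 'x::fd_complex_hilbert \<Rightarrow> 'y::fd_complex_hilbert) \<Rightarrow>
   ('g \<Rightarrow> 'v \<Rightarrow> 'v) \<Rightarrow> ('g \<Rightarrow> 'x \<Rightarrow> 'x) \<Rightarrow> ('v, 'g) gain_graph \<Rightarrow>
   (('g \<Rightarrow> complex) \<Rightarrow> ('v set \<Rightarrow> 'x) \<Rightarrow> 'v set set \<Rightarrow> 'y) \<Rightarrow> bool" where
  "is_symbol_function \<mu> V E \<phi> \<theta> \<tau> Q \<Phi> \<longleftrightarrow>
     \<Phi> \<in> Linf_ops \<mu> (vertex_orbits V \<theta>) (edge_orbits E \<theta>) \<and>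
     graph_on (ell2 V) (coboundary E \<phi>) =
       graph_on (ell2 V) (S_V V \<theta> Q) O
       graph_on (ell2_vecs (vertex_orbits V \<theta>)) (twist \<tau>) O
       fourier \<mu> (vertex_orbits V \<theta>) O
       graph_on (L2_vecs \<mu> (vertex_orbits V \<theta>)) (multiplication \<Phi>) O
       (fourier \<mu> (edge_orbits E \<theta>))\<inverse> O
       (graph_on (ell2 E) (S_E E \<theta> Q))\<inverse>"


section \<open>The orbit matrix\<close>

definition orbit_matrix ::
  "('v \<Rightarrow> 'v \<Rightarrow> 'x::fd_complex_hilbert \<Rightarrow> 'y::fd_complex_hilbert) \<Rightarrow>
   ('g::ab_group_add \<Rightarrow> 'v \<Rightarrow> 'v) \<Rightarrow> ('v, 'g) gain_graph \<Rightarrow> ('g \<Rightarrow> complex) \<Rightarrow>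
   'v set set \<Rightarrow> 'v set \<Rightarrow> 'x \<Rightarrow> 'y" where
  "orbit_matrix \<phi> \<theta> Q \<xi> c a =
     (let v = rep Q (tail Q c); w = rep Q (head Q c); \<gamma> = gain Q c in
      if tail Q c \<noteq> head Q c then
        (if a = tail Q c then \<phi> v (\<theta> \<gamma> w)
         else if a = head Q c then (\<lambda>x. \<xi> \<gamma> *\<^sub>C \<phi> w (\<theta> (- \<gamma>) v) x)
         else (\<lambda>x. 0))
      else
        (if a = tail Q c then (\<lambda>x. \<phi> v (\<theta> \<gamma> v) x + \<xi> \<gamma> *\<^sub>C \<phi> v (\<theta> (- \<gamma>) v) x)
         else (\<lambda>x. 0)))"

definition orbit_operator ::
  "'v set \<Rightarrow> 'v set set \<Rightarrow> ('v \<Rightarrow> 'v \<Rightarrow> 'x::fd_complex_hilbert \<Rightarrow> 'y::fd_complex_hilbert) \<Rightarrow>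
   ('g::ab_group_add \<Rightarrow> 'v \<Rightarrow> 'v) \<Rightarrow> ('v, 'g) gain_graph \<Rightarrow> ('g \<Rightarrow> complex) \<Rightarrow>
   ('v set \<Rightarrow> 'x) \<Rightarrow> 'v set set \<Rightarrow> 'y" where
  "orbit_operator V E \<phi> \<theta> Q \<xi> x =
     (\<lambda>c. if c \<in> edge_orbits E \<theta>
          then (\<Sum>a\<in>vertex_orbits V \<theta>. orbit_matrix \<phi> \<theta> Q \<xi> c a (x a)) else 0)"

end

theory Submission
  imports Defs
begin

text \<open>
  The symbol is determined column by column, by feeding the factorization vectors concentrated on a
  single representative vertex. Let \<open>z\<close> have the value \<open>x\<close> at the representative of the orbit \<open>a\<close>
  and vanish elsewhere. Because the action is free, \<open>S\<^sub>V z\<close> is concentrated at \<open>0 \<in> \<Gamma>\<close>, where the twist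
  is the identity, so its Fourier transform is the constant function with value \<open>x\<close> in the
  coordinate \<open>a\<close> (\<open>unit_vec a x\<close>). The factorization therefore says that
  \<open>\<chi> \<mapsto> \<Phi>(\<chi>) (unit_vec a x)\<close> is the Fourier transform of \<open>S\<^sub>E (C z)\<close>.

  A row \<open>\<gamma> e\<close> of \<open>C z\<close>, with \<open>e\<close> the representative edge joining \<open>v\<close> to \<open>\<delta> w\<close>, involves the support of
  \<open>z\<close> only if \<open>\<gamma> = 0\<close> and \<open>v\<close> represents \<open>a\<close>, or \<open>\<gamma> = - \<delta>\<close> and \<open>w\<close> represents \<open>a\<close>
  (\<open>coboundary_point_mass\<close>). So \<open>S\<^sub>E (C z)\<close> is finitely supported as well, its transform is a
  finite sum, and the two possible terms carry the coefficients \<open>cnj (\<chi> 0) = 1\<close> and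
  \<open>cnj (\<chi> (- \<delta>)) = \<chi> \<delta>\<close>: they are exactly the two contributions to the column \<open>a\<close> of the orbit
  matrix (\<open>transform_point_mass\<close>).

  For each \<open>a\<close> and \<open>x\<close> this is an identity outside a null set depending on \<open>a\<close> and \<open>x\<close>. Finitely many
  such vectors span the space of functions from \<open>V\<^sub>0\<close> to \<open>X\<close>, and both sides are linear, so a single
  null set suffices (\<open>vecs_span_induct\<close>).
\<close>

section \<open>Complex linear algebra\<close>

lemma scaleC_zero_left: "0 *\<^sub>C x = (0::'x::fd_complex_hilbert)"
  using scaleR_scaleC[of 0 x] by simp

lemma scaleC_one: "1 *\<^sub>C x = (x::'x::fd_complex_hilbert)"
  using scaleR_scaleC[of 1 x] by simp

lemma scaleC_zero_right: "a *\<^sub>C (0::'x::fd_complex_hilbert) = 0"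
  using scaleC_add_right[of a 0 0] by simp

lemma scaleC_sum_right:
  "a *\<^sub>C (\<Sum>i\<in>I. f i) = (\<Sum>i\<in>I. a *\<^sub>C (f i :: 'x::fd_complex_hilbert))"
  by (induction I rule: infinite_finite_induct) (simp_all add: scaleC_zero_right scaleC_add_right)

lemma scaleC_eq_Re_Im:
  "a *\<^sub>C x = Re a *\<^sub>R x + Im a *\<^sub>R (\<i> *\<^sub>C (x::'x::fd_complex_hilbert))"
proof -
  have "a *\<^sub>C x = (complex_of_real (Re a) + complex_of_real (Im a) * \<i>) *\<^sub>C x"
    by (metis complex_eq mult.commute)
  then show ?thesis by (simp add: scaleC_add_left scaleR_scaleC scaleC_scaleC)
qed

lemma complex_linear_zero: "complex_linear f \<Longrightarrow> f 0 = 0"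
  unfolding complex_linear_def by (metis scaleC_zero_left)

definition unit_vec :: "'i \<Rightarrow> 'x::zero \<Rightarrow> 'i \<Rightarrow> 'x" where
  "unit_vec a x = (\<lambda>i. if i = a then x else 0)"

lemma unit_vec_in_vecs: "a \<in> I \<Longrightarrow> unit_vec a x \<in> vecs I"
  by (auto simp: unit_vec_def vecs_def)

text \<open>
  To check a linear identity on all vectors, it suffices to check it on vectors with one nonzero
  coordinate, taken from a spanning set.
\<close>

lemma vecs_span_induct [consumes 3, case_names zero add scale unit]:
  fixes x :: "'i \<Rightarrow> 'x::fd_complex_hilbert"
  assumes "finite I" and span: "\<And>y::'x. \<exists>c. y = (\<Sum>b\<in>B. c b *\<^sub>C b)" and x: "x \<in> vecs I"
    and zero: "P (\<lambda>i. 0)"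
    and add: "\<And>x y. x \<in> vecs I \<Longrightarrow> y \<in> vecs I \<Longrightarrow> P x \<Longrightarrow> P y \<Longrightarrow> P (\<lambda>i. x i + y i)"
    and scale: "\<And>a x. x \<in> vecs I \<Longrightarrow> P x \<Longrightarrow> P (\<lambda>i. a *\<^sub>C x i)"
    and unit: "\<And>a b. a \<in> I \<Longrightarrow> b \<in> B \<Longrightarrow> P (unit_vec a b)"
  shows "P x"
proof -
  have sum: "(\<lambda>i. \<Sum>k\<in>K. u k i) \<in> vecs I \<and> P (\<lambda>i. \<Sum>k\<in>K. u k i)"
    if "\<And>k. k \<in> K \<Longrightarrow> u k \<in> vecs I \<and> P (u k)" for K and u :: "'k \<Rightarrow> 'i \<Rightarrow> 'x"
    using that
  proof (induction K rule: infinite_finite_induct)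
    case (insert k K)
    then have "P (\<lambda>i. u k i + (\<Sum>k\<in>K. u k i))" by (intro add) auto
    moreover have "(\<lambda>i. u k i + (\<Sum>k\<in>K. u k i)) \<in> vecs I" using insert by (auto simp: vecs_def)
    ultimately show ?case using insert by simp
  qed (auto simp: vecs_def zero)
  have unit_any: "P (unit_vec a y)" if "a \<in> I" for a and y :: 'x
  proof -
    obtain c where c: "y = (\<Sum>b\<in>B. c b *\<^sub>C b)" using span by blast
    have "P (\<lambda>i. \<Sum>b\<in>B. c b *\<^sub>C unit_vec a b i)"
    proof (rule conjunct2[OF sum])
      fix b assume "b \<in> B"
      then show "(\<lambda>i. c b *\<^sub>C unit_vec a b i) \<in> vecs I \<and> P (\<lambda>i. c b *\<^sub>C unit_vec a b i)"
        using scale[OF unit_vec_in_vecs[OF that] unit[OF that]] that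
        by (auto simp: vecs_def unit_vec_def scaleC_zero_right)
    qed
    also have "(\<lambda>i. \<Sum>b\<in>B. c b *\<^sub>C unit_vec a b i) = unit_vec a y"
      by (auto simp: unit_vec_def c scaleC_zero_right fun_eq_iff)
    finally show ?thesis .
  qed
  have "P (\<lambda>i. \<Sum>a\<in>I. unit_vec a (x a) i)"
    by (rule conjunct2[OF sum]) (auto simp: unit_any unit_vec_in_vecs)
  also have "(\<lambda>i. \<Sum>a\<in>I. unit_vec a (x a) i) = x"
    using \<open>finite I\<close> x by (auto simp: unit_vec_def vecs_def fun_eq_iff)
  finally show ?thesis .
qed

section \<open>Fourier transforms of finitely supported functions\<close>

lemma space_haar: "haar_prob_measure \<mu> \<Longrightarrow> space \<mu> = dual_group"
  by (auto simp: haar_prob_measure_def space_restrict_space dest: sets_eq_imp_space_eq)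

lemma character_zero:
  assumes "\<xi> \<in> dual_group"
  shows "\<xi> 0 = 1"
proof -
  have "\<xi> (0 + 0) = \<xi> 0 * \<xi> 0" "cmod (\<xi> 0) = 1"
    using assms unfolding dual_group_def by blast+
  then show ?thesis by auto
qed

lemma character_measurable:
  assumes "haar_prob_measure \<mu>"
  shows "(\<lambda>\<xi>. \<xi> \<gamma>) \<in> borel_measurable \<mu>"
proof -
  have "(\<lambda>\<xi>::'a \<Rightarrow> complex. \<xi> \<gamma>) \<in> borel_measurable borel"
    by (intro borel_measurable_continuous_onI continuous_on_product_coordinates)
  then have "(\<lambda>\<xi>::'a \<Rightarrow> complex. \<xi> \<gamma>) \<in> borel_measurable (restrict_space borel dual_group)"
    by (rule measurable_restrict_space1)
  moreover have "sets \<mu> = sets (restrict_space borel dual_group)"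
    using assms by (simp add: haar_prob_measure_def)
  ultimately show ?thesis by (simp cong: measurable_cong_sets)
qed

text \<open>
  The partial sums of the transform are eventually constant, so the squared norm of the difference of
  the two sides integrates to zero. To conclude that the difference vanishes almost everywhere one
  needs measurability, and sums of measurable functions can fail to be measurable unless the
  topology of the range has a countable base. The difference is therefore paired with the members of a
  finite spanning set: the pairings are real-valued and measurable, and together they detect zero.
\<close>

lemma fourier_finite_support:
  fixes f :: "'g::ab_group_add \<Rightarrow> 'i \<Rightarrow> 'x::fd_complex_hilbert"
  assumes haar: "haar_prob_measure \<mu>" and I: "finite I" and fh: "(f, h) \<in> fourier \<mu> I"
    and S: "finite S" and supp: "\<And>\<gamma>. \<gamma> \<notin> S \<Longrightarrow> f \<gamma> = (\<lambda>i. 0)"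
  shows "AE \<xi> in \<mu>. h \<xi> = (\<lambda>i. \<Sum>\<gamma>\<in>S. cnj (\<xi> \<gamma>) *\<^sub>C f \<gamma> i)"
proof -
  define d where "d \<xi> i = h \<xi> i - (\<Sum>\<gamma>\<in>S. cnj (\<xi> \<gamma>) *\<^sub>C f \<gamma> i)" for \<xi> i
  have f: "f \<in> ell2_vecs I" and h: "h \<in> L2_vecs \<mu> I"
    and lim: "((\<lambda>S. \<integral>\<^sup>+ \<xi>. ennreal (norm_sq I (\<lambda>i. h \<xi> i - (\<Sum>\<gamma>\<in>S. cnj (\<xi> \<gamma>) *\<^sub>C f \<gamma> i))) \<partial>\<mu>)
        \<longlongrightarrow> 0) (finite_subsets_at_top UNIV)"
    using fh by (auto simp: fourier_def)
  \<comment> \<open>The partial sums are constant once they contain the support.\<close>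
  have "eventually (\<lambda>T. (\<integral>\<^sup>+ \<xi>. ennreal (norm_sq I (\<lambda>i. h \<xi> i - (\<Sum>\<gamma>\<in>T. cnj (\<xi> \<gamma>) *\<^sub>C f \<gamma> i))) \<partial>\<mu>)
          = (\<integral>\<^sup>+ \<xi>. ennreal (norm_sq I (d \<xi>)) \<partial>\<mu>)) (finite_subsets_at_top UNIV)"
    unfolding eventually_finite_subsets_at_top
  proof (intro exI[of _ S] conjI allI impI)
    fix T :: "'g set" assume T: "finite T \<and> S \<subseteq> T \<and> T \<subseteq> UNIV"
    have "(\<Sum>\<gamma>\<in>T. cnj (\<xi> \<gamma>) *\<^sub>C f \<gamma> i) = (\<Sum>\<gamma>\<in>S. cnj (\<xi> \<gamma>) *\<^sub>C f \<gamma> i)" for \<xi> i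
      using T supp by (intro sum.mono_neutral_right) (auto simp: scaleC_zero_right)
    then show "(\<integral>\<^sup>+ \<xi>. ennreal (norm_sq I (\<lambda>i. h \<xi> i - (\<Sum>\<gamma>\<in>T. cnj (\<xi> \<gamma>) *\<^sub>C f \<gamma> i))) \<partial>\<mu>)
          = (\<integral>\<^sup>+ \<xi>. ennreal (norm_sq I (d \<xi>)) \<partial>\<mu>)"
      by (simp add: d_def[abs_def])
  qed (use S in auto)
  from tendsto_cong[OF this] lim
  have "((\<lambda>T::'g set. \<integral>\<^sup>+ \<xi>. ennreal (norm_sq I (d \<xi>)) \<partial>\<mu>) \<longlongrightarrow> 0) (finite_subsets_at_top UNIV)"
    by simp
  then have int0: "(\<integral>\<^sup>+ \<xi>. ennreal (norm_sq I (d \<xi>)) \<partial>\<mu>) = 0"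
    by (subst (asm) tendsto_const_iff) auto
  have pair0: "AE \<xi> in \<mu>. inner (d \<xi> i) v = 0" if i: "i \<in> I" for i v
  proof -
    have hm: "(\<lambda>\<xi>. h \<xi> i) \<in> borel_measurable \<mu>" using h i by (auto simp: L2_vecs_def)
    have "continuous_on UNIV (\<lambda>y::'x. inner y v)" by (intro continuous_intros)
    from measurable_compose[OF hm borel_measurable_continuous_onI[OF this]]
    have [measurable]: "(\<lambda>\<xi>. inner (h \<xi> i) v) \<in> borel_measurable \<mu>" .
    note [measurable] = character_measurable[OF haar]
    have eq: "inner (d \<xi> i) v = inner (h \<xi> i) v - (\<Sum>\<gamma>\<in>S. Re (\<xi> \<gamma>) * inner (f \<gamma> i) v
             - Im (\<xi> \<gamma>) * inner (\<i> *\<^sub>C f \<gamma> i) v)" for \<xi>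
      unfolding d_def
      by (subst scaleC_eq_Re_Im) (simp add: inner_diff_left inner_sum_left inner_add_left)
    have [measurable]: "(\<lambda>\<xi>. inner (d \<xi> i) v) \<in> borel_measurable \<mu>"
      unfolding eq by measurable
    \<comment> \<open>The Cauchy-Schwarz inequality is divided by the norm of \<open>v\<close> because a constant factor can be
      taken out of an integral only for a measurable integrand. For \<open>v = 0\<close> the quotient is \<open>0\<close>.\<close>
    have "(\<integral>\<^sup>+ \<xi>. ennreal ((inner (d \<xi> i) v)\<^sup>2 / (norm v)\<^sup>2) \<partial>\<mu>)
        \<le> (\<integral>\<^sup>+ \<xi>. ennreal (norm_sq I (d \<xi>)) \<partial>\<mu>)"
    proof (intro nn_integral_mono ennreal_leI)
      fix \<xi>
      have "(inner (d \<xi> i) v)\<^sup>2 \<le> (norm (d \<xi> i))\<^sup>2 * (norm v)\<^sup>2"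
        by (metis Cauchy_Schwarz_ineq power2_norm_eq_inner)
      then have "(inner (d \<xi> i) v)\<^sup>2 / (norm v)\<^sup>2 \<le> (norm (d \<xi> i))\<^sup>2"
        by (cases "v = 0") (simp_all add: divide_le_eq)
      also have "\<dots> \<le> norm_sq I (d \<xi>)"
        unfolding norm_sq_def using I i by (intro member_le_sum) auto
      finally show "(inner (d \<xi> i) v)\<^sup>2 / (norm v)\<^sup>2 \<le> norm_sq I (d \<xi>)" .
    qed
    then have "(\<integral>\<^sup>+ \<xi>. ennreal ((inner (d \<xi> i) v)\<^sup>2 / (norm v)\<^sup>2) \<partial>\<mu>) = 0"
      by (simp add: int0)
    then have "AE \<xi> in \<mu>. ennreal ((inner (d \<xi> i) v)\<^sup>2 / (norm v)\<^sup>2) = 0"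
      by (subst (asm) nn_integral_0_iff_AE) auto
    then show ?thesis
    proof (rule AE_mp, intro AE_I2 impI)
      fix \<xi> assume "ennreal ((inner (d \<xi> i) v)\<^sup>2 / (norm v)\<^sup>2) = 0"
      then have "(inner (d \<xi> i) v)\<^sup>2 / (norm v)\<^sup>2 \<le> 0" by (simp only: ennreal_eq_0_iff)
      then show "inner (d \<xi> i) v = 0" by (cases "v = 0") (simp_all add: divide_le_eq)
    qed
  qed
  obtain B :: "'x set" where B: "finite B" and span: "\<And>x. \<exists>c. x = (\<Sum>b\<in>B. c b *\<^sub>C b)"
    using finite_dimensional by blast
  \<comment> \<open>\<open>B\<close> spans over the complex numbers; over the reals, the multiples by \<open>\<i>\<close> are needed as well.\<close>
  have "AE \<xi> in \<mu>. \<forall>i\<in>I. \<forall>b\<in>B. inner (d \<xi> i) b = 0 \<and> inner (d \<xi> i) (\<i> *\<^sub>C b) = 0"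
    using I B pair0 by (intro AE_finite_allI AE_conjI) auto
  then show ?thesis
  proof (rule AE_mp, intro AE_I2 impI ext)
    fix \<xi> i
    assume \<xi>: "\<xi> \<in> space \<mu>"
      and 0: "\<forall>i\<in>I. \<forall>b\<in>B. inner (d \<xi> i) b = 0 \<and> inner (d \<xi> i) (\<i> *\<^sub>C b) = 0"
    show "h \<xi> i = (\<Sum>\<gamma>\<in>S. cnj (\<xi> \<gamma>) *\<^sub>C f \<gamma> i)"
    proof (cases "i \<in> I")
      case True
      obtain c where c: "d \<xi> i = (\<Sum>b\<in>B. c b *\<^sub>C b)" using span by blast
      have "inner (d \<xi> i) (\<Sum>b\<in>B. c b *\<^sub>C b) = 0"
        unfolding inner_sum_right using 0 True
        by (intro sum.neutral ballI, subst scaleC_eq_Re_Im) (auto simp: inner_add_right)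
      then have "d \<xi> i = 0" unfolding c[symmetric] by simp
      then show ?thesis by (simp add: d_def)
    next
      case False
      then have "h \<xi> i = 0" using h \<xi> by (auto simp: L2_vecs_def vecs_def space_haar[OF haar])
      moreover have "f \<gamma> i = 0" for \<gamma> using f False by (auto simp: ell2_vecs_def vecs_def)
      ultimately show ?thesis by (simp add: scaleC_zero_right)
    qed
  qed
qed

section \<open>Free actions and gain graphs\<close>

locale framework_with_gains =
  fixes V :: "'v set" and E :: "'v set set"
    and \<phi> :: "'v \<Rightarrow> 'v \<Rightarrow> 'x::fd_complex_hilbert \<Rightarrow> 'y::fd_complex_hilbert"
    and \<theta> :: "'g::ab_group_add \<Rightarrow> 'v \<Rightarrow> 'v"
    and \<tau> :: "'g \<Rightarrow> 'x \<Rightarrow> 'x"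
    and Q :: "('v, 'g) gain_graph"
  assumes symmetric: "symmetric_framework V E \<phi> \<theta> \<tau>"
    and gains: "is_gain_graph V E \<theta> Q"
begin

abbreviation "V\<^sub>0 \<equiv> vertex_orbits V \<theta>"
abbreviation "E\<^sub>0 \<equiv> edge_orbits E \<theta>"

lemma finite_orbits: "finite V\<^sub>0" "finite E\<^sub>0"
  using symmetric by (auto simp: symmetric_framework_def)

lemma action_closed: "v \<in> V \<Longrightarrow> \<theta> \<gamma> v \<in> V"
  using symmetric by (auto simp: symmetric_framework_def graph_action_def bij_betw_def)

lemma action_add: "v \<in> V \<Longrightarrow> \<theta> (\<gamma> + \<delta>) v = \<theta> \<gamma> (\<theta> \<delta> v)"
  using symmetric by (auto simp: symmetric_framework_def graph_action_def)

lemma action_zero: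
  assumes "v \<in> V"
  shows "\<theta> 0 v = v"
proof -
  have "inj_on (\<theta> 0) V"
    using symmetric by (auto simp: symmetric_framework_def graph_action_def bij_betw_def)
  moreover have "\<theta> 0 (\<theta> 0 v) = \<theta> 0 v" using action_add[OF assms, of 0 0] by simp
  ultimately show ?thesis using assms action_closed by (auto dest: inj_onD)
qed

lemma action_free: "v \<in> V \<Longrightarrow> \<theta> \<gamma> v = v \<Longrightarrow> \<gamma> = 0"
  using symmetric by (auto simp: symmetric_framework_def)

lemma edge_vertices: "{u, w} \<in> E \<Longrightarrow> u \<in> V \<and> w \<in> V \<and> u \<noteq> w"
  using symmetric
  by (fastforce simp: symmetric_framework_def framework_def simple_graph_def card_insert_if
      split: if_splits)

lemma edge_image:
  assumes "e \<in> E"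
  shows "\<theta> \<gamma> ` e \<in> E"
proof -
  obtain p q where e: "e = {p, q}"
    using assms symmetric
    by (metis card_2_iff symmetric_framework_def framework_def simple_graph_def)
  then show ?thesis
    using edge_vertices[of p q] assms symmetric
    by (simp add: symmetric_framework_def graph_action_def)
qed

lemma linear_entry: "v \<in> V \<Longrightarrow> w \<in> V \<Longrightarrow> complex_linear (\<phi> v w)"
  using symmetric by (auto simp: symmetric_framework_def framework_def)

lemma linear_part_zero: "linear_part (\<tau> 0) x = x"
proof -
  have "bij (\<tau> 0)" "\<tau> 0 \<circ> \<tau> 0 = \<tau> 0"
    using symmetric by (auto simp: symmetric_framework_def affine_isometry_def)
      (metis add_0)
  then have "\<tau> 0 y = y" for y by (metis bij_is_inj comp_apply injD)
  then show ?thesis by (simp add: linear_part_def)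
qed

lemma twist_supported_at_zero:
  assumes "\<And>\<gamma>. \<gamma> \<noteq> 0 \<Longrightarrow> f \<gamma> = (\<lambda>i. 0)"
  shows "twist \<tau> f = f"
proof (intro ext)
  fix \<gamma> i
  show "twist \<tau> f \<gamma> i = f \<gamma> i"
    using assms[of \<gamma>]
    by (cases "\<gamma> = 0") (simp_all add: twist_def linear_part_zero, simp add: linear_part_def)
qed

lemma vertex_orbit_action:
  assumes "v \<in> V"
  shows "vertex_orbit \<theta> (\<theta> \<gamma> v) = vertex_orbit \<theta> v"
proof -
  have "\<theta> \<delta> (\<theta> \<gamma> v) = \<theta> (\<delta> + \<gamma>) v" and "\<theta> \<delta> v = \<theta> (\<delta> - \<gamma>) (\<theta> \<gamma> v)" for \<delta>
    using assms action_add[of v "\<delta> - \<gamma>" \<gamma>] by (simp_all add: action_add)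
  then show ?thesis unfolding vertex_orbit_def by blast
qed

lemma
  assumes "a \<in> V\<^sub>0"
  shows rep_vertex: "rep Q a \<in> V" and rep_orbit: "vertex_orbit \<theta> (rep Q a) = a"
proof -
  obtain v where v: "v \<in> V" "a = vertex_orbit \<theta> v" using assms by (auto simp: vertex_orbits_def)
  moreover have "rep Q a \<in> a" using gains assms by (auto simp: is_gain_graph_def)
  ultimately obtain \<gamma> where "rep Q a = \<theta> \<gamma> v" by (auto simp: vertex_orbit_def)
  then show "rep Q a \<in> V" "vertex_orbit \<theta> (rep Q a) = a"
    using v by (simp_all add: action_closed vertex_orbit_action)
qed

lemma action_rep_eq_rep_iff:
  assumes "a \<in> V\<^sub>0" "b \<in> V\<^sub>0"
  shows "\<theta> \<gamma> (rep Q b) = rep Q a \<longleftrightarrow> \<gamma> = 0 \<and> b = a"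
proof
  assume eq: "\<theta> \<gamma> (rep Q b) = rep Q a"
  then have "a = b"
    using assms vertex_orbit_action[OF rep_vertex[OF assms(2)], of \<gamma>] by (simp add: rep_orbit)
  then show "\<gamma> = 0 \<and> b = a" using eq assms action_free[OF rep_vertex] by auto
qed (use assms in \<open>auto simp: action_zero rep_vertex\<close>)

lemma
  assumes "c \<in> E\<^sub>0"
  shows tail_orbit: "tail Q c \<in> V\<^sub>0" and head_orbit: "head Q c \<in> V\<^sub>0"
    and edge_rep_edge: "edge_rep \<theta> Q c \<in> E"
proof -
  show "tail Q c \<in> V\<^sub>0" "head Q c \<in> V\<^sub>0" using gains assms by (auto simp: is_gain_graph_def)
  have "edge_rep \<theta> Q c \<in> c" using gains assms by (auto simp: is_gain_graph_def)
  then show "edge_rep \<theta> Q c \<in> E"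
    using assms edge_image by (auto simp: edge_orbits_def edge_orbit_def)
qed

section \<open>The response to a point mass\<close>

definition point_mass :: "'v set \<Rightarrow> 'x \<Rightarrow> 'v \<Rightarrow> 'x" where
  "point_mass a x = unit_vec (rep Q a) x"

lemma point_mass_ell2:
  assumes "a \<in> V\<^sub>0"
  shows "point_mass a x \<in> ell2 V"
proof -
  have "(\<lambda>u. (norm (point_mass a x u))\<^sup>2) summable_on V"
    using summable_on_cong_neutral[of "{rep Q a}" V "\<lambda>u. (norm (point_mass a x u))\<^sup>2"
        "\<lambda>u. (norm (point_mass a x u))\<^sup>2"] assms
    by (auto simp: point_mass_def unit_vec_def rep_vertex)
  then show ?thesis
    using assms by (auto simp: ell2_def point_mass_def unit_vec_in_vecs rep_vertex)
qed

lemma point_mass_action_rep: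
  "a \<in> V\<^sub>0 \<Longrightarrow> b \<in> V\<^sub>0 \<Longrightarrow> point_mass a x (\<theta> \<gamma> (rep Q b)) = (if \<gamma> = 0 \<and> b = a then x else 0)"
  by (simp add: point_mass_def unit_vec_def action_rep_eq_rep_iff)

lemma S_V_point_mass:
  assumes "a \<in> V\<^sub>0"
  shows "S_V V \<theta> Q (point_mass a x) = (\<lambda>\<gamma>. if \<gamma> = 0 then unit_vec a x else (\<lambda>i. 0))"
  using assms by (auto simp: S_V_def point_mass_action_rep unit_vec_def fun_eq_iff)

lemma coboundary_edge:
  assumes "{u, w} \<in> E"
  shows "coboundary E \<phi> z {u, w} = \<phi> u w (z u) + \<phi> w u (z w)"
proof -
  have "u \<noteq> w" using edge_vertices[OF assms] by simp
  then have "{u, w} - {u} = {w}" "{u, w} - {w} = {u}" by auto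
  with \<open>u \<noteq> w\<close> assms show ?thesis by (simp add: coboundary_def coboundary_entry_def)
qed

text \<open>
  Only two translates of a representative edge can meet the support of the point mass: the edge itself,
  at its tail, and the translate by the negative gain, at its head.
\<close>

lemma coboundary_point_mass:
  fixes c defines "v \<equiv> rep Q (tail Q c)" and "w \<equiv> rep Q (head Q c)" and "\<delta> \<equiv> gain Q c"
  assumes a: "a \<in> V\<^sub>0" and c: "c \<in> E\<^sub>0"
  shows "S_E E \<theta> Q (coboundary E \<phi> (point_mass a x)) \<gamma> c =
     (if \<gamma> = 0 then if tail Q c = a then \<phi> v (\<theta> \<delta> w) x else 0 else 0) +
     (if \<gamma> = - \<delta> then if head Q c = a then \<phi> w (\<theta> (- \<delta>) v) x else 0 else 0)"
proof -
  have v: "v \<in> V" and w: "w \<in> V"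
    using c by (auto simp: v_def w_def rep_vertex tail_orbit head_orbit)
  have img: "\<theta> \<gamma> ` edge_rep \<theta> Q c = {\<theta> \<gamma> v, \<theta> (\<gamma> + \<delta>) w}"
    using action_add[OF w] by (simp add: edge_rep_def v_def w_def \<delta>_def)
  then have "{\<theta> \<gamma> v, \<theta> (\<gamma> + \<delta>) w} \<in> E" using edge_image[OF edge_rep_edge[OF c], of \<gamma>] by simp
  note cob = coboundary_edge[OF this, of "point_mass a x"]
  have pv: "point_mass a x (\<theta> \<gamma> v) = (if \<gamma> = 0 \<and> tail Q c = a then x else 0)"
    unfolding v_def by (rule point_mass_action_rep[OF a tail_orbit[OF c]])
  have pw: "point_mass a x (\<theta> (\<gamma> + \<delta>) w) = (if \<gamma> = - \<delta> \<and> head Q c = a then x else 0)"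
    unfolding w_def eq_neg_iff_add_eq_0 by (rule point_mass_action_rep[OF a head_orbit[OF c]])
  have "\<phi> (\<theta> \<gamma> v) (\<theta> (\<gamma> + \<delta>) w) (point_mass a x (\<theta> \<gamma> v)) =
      (if \<gamma> = 0 then if tail Q c = a then \<phi> v (\<theta> \<delta> w) x else 0 else 0)"
    using v w complex_linear_zero[OF linear_entry] by (auto simp: pv action_closed action_zero)
  moreover have "\<phi> (\<theta> (\<gamma> + \<delta>) w) (\<theta> \<gamma> v) (point_mass a x (\<theta> (\<gamma> + \<delta>) w)) =
      (if \<gamma> = - \<delta> then if head Q c = a then \<phi> w (\<theta> (- \<delta>) v) x else 0 else 0)"
    unfolding pw using v w complex_linear_zero[OF linear_entry]
    by (auto simp: action_closed action_zero)
  ultimately show ?thesis using c by (simp add: S_E_def img cob)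
qed

lemma linear_orbit_matrix:
  assumes c: "c \<in> E\<^sub>0"
  shows "complex_linear (orbit_matrix \<phi> \<theta> Q \<xi> c a)"
proof -
  have V: "rep Q (tail Q c) \<in> V" "rep Q (head Q c) \<in> V"
    using c by (auto simp: rep_vertex tail_orbit head_orbit)
  then have "complex_linear (\<phi> (rep Q (tail Q c)) (\<theta> \<gamma> (rep Q (head Q c))))"
    "complex_linear (\<phi> (rep Q (head Q c)) (\<theta> \<gamma> (rep Q (tail Q c))))" for \<gamma>
    by (simp_all add: linear_entry action_closed)
  then show ?thesis
    by (auto simp: orbit_matrix_def Let_def complex_linear_def scaleC_add_right scaleC_scaleC
        scaleC_zero_right mult.commute)
qed

text \<open>
  The two cases in the definition of the orbit matrix are unified here: a loop is an edge for which
  both the tail and the head term occur in the same column.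
\<close>

lemma orbit_operator_unit_vec:
  assumes a: "a \<in> V\<^sub>0" and c: "c \<in> E\<^sub>0"
  shows "orbit_operator V E \<phi> \<theta> Q \<xi> (unit_vec a x) c =
     (if tail Q c = a then \<phi> (rep Q (tail Q c)) (\<theta> (gain Q c) (rep Q (head Q c))) x else 0) +
     (if head Q c = a
      then \<xi> (gain Q c) *\<^sub>C \<phi> (rep Q (head Q c)) (\<theta> (- gain Q c) (rep Q (tail Q c))) x else 0)"
proof -
  have "orbit_operator V E \<phi> \<theta> Q \<xi> (unit_vec a x) c =
      (\<Sum>b\<in>V\<^sub>0. if b = a then orbit_matrix \<phi> \<theta> Q \<xi> c b x else 0)"
    using c complex_linear_zero[OF linear_orbit_matrix[OF c]]
    by (auto simp: orbit_operator_def unit_vec_def intro!: sum.cong)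
  also have "\<dots> = orbit_matrix \<phi> \<theta> Q \<xi> c a x" using a finite_orbits by simp
  finally show ?thesis by (auto simp: orbit_matrix_def Let_def)
qed

lemma transform_point_mass:
  assumes a: "a \<in> V\<^sub>0" and \<xi>: "\<xi> \<in> dual_group"
    and S: "finite S" "0 \<in> S" "\<And>c. c \<in> E\<^sub>0 \<Longrightarrow> - gain Q c \<in> S"
  shows "(\<lambda>c. \<Sum>\<gamma>\<in>S. cnj (\<xi> \<gamma>) *\<^sub>C S_E E \<theta> Q (coboundary E \<phi> (point_mass a x)) \<gamma> c) =
         orbit_operator V E \<phi> \<theta> Q \<xi> (unit_vec a x)"
proof (rule ext)
  fix c
  show "(\<Sum>\<gamma>\<in>S. cnj (\<xi> \<gamma>) *\<^sub>C S_E E \<theta> Q (coboundary E \<phi> (point_mass a x)) \<gamma> c) =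
        orbit_operator V E \<phi> \<theta> Q \<xi> (unit_vec a x) c"
  proof (cases "c \<in> E\<^sub>0")
    case True
    have add: "\<xi> (\<gamma> + \<delta>) = \<xi> \<gamma> * \<xi> \<delta>" and mod: "cmod (\<xi> \<gamma>) = 1" for \<gamma> \<delta>
      using \<xi> by (auto simp: dual_group_def)
    have "\<xi> (gain Q c) * \<xi> (- gain Q c) = 1" using add[of "gain Q c" "- gain Q c"] character_zero[OF \<xi>] by simp
    moreover have "cnj (\<xi> (- gain Q c)) * \<xi> (- gain Q c) = 1"
      using mod[of "- gain Q c"] by (simp add: mult.commute complex_norm_square[symmetric])
    ultimately have conj: "cnj (\<xi> (- gain Q c)) = \<xi> (gain Q c)"
      by (metis mult_right_cancel mult_zero_right zero_neq_one)
    have if_scale: "s *\<^sub>C (if P then y else 0) = (if P then s *\<^sub>C y else 0)" for s P and y :: 'y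
      by (simp add: scaleC_zero_right)
    show ?thesis
      unfolding coboundary_point_mass[OF a True] orbit_operator_unit_vec[OF a True]
      by (simp add: scaleC_add_right if_scale sum.distrib S True character_zero[OF \<xi>] conj scaleC_one)
  qed (simp add: S_E_def orbit_operator_def scaleC_zero_right)
qed

lemma orbit_operator_add:
  "orbit_operator V E \<phi> \<theta> Q \<xi> (\<lambda>i. x i + y i) =
     (\<lambda>c. orbit_operator V E \<phi> \<theta> Q \<xi> x c + orbit_operator V E \<phi> \<theta> Q \<xi> y c)"
  using linear_orbit_matrix
  by (auto simp: orbit_operator_def fun_eq_iff complex_linear_def sum.distrib)

lemma orbit_operator_scale:
  "orbit_operator V E \<phi> \<theta> Q \<xi> (\<lambda>i. s *\<^sub>C x i) =
     (\<lambda>c. s *\<^sub>C orbit_operator V E \<phi> \<theta> Q \<xi> x c)"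
  using linear_orbit_matrix
  by (auto simp: orbit_operator_def fun_eq_iff complex_linear_def scaleC_sum_right
      scaleC_zero_right)

text \<open>
  The factorization provides some representative \<open>h\<close> of the transform of the point mass. It agrees with the
  constant \<open>unit_vec a x\<close> only almost everywhere, but as \<open>\<Phi>\<close> acts pointwise this suffices to evaluate
  \<open>\<Phi>\<close> on the constant.
\<close>

lemma symbol_unit_vec:
  assumes haar: "haar_prob_measure \<mu>" and symbol: "is_symbol_function \<mu> V E \<phi> \<theta> \<tau> Q \<Phi>"
    and a: "a \<in> V\<^sub>0"
  shows "AE \<xi> in \<mu>. \<Phi> \<xi> (unit_vec a x) = orbit_operator V E \<phi> \<theta> Q \<xi> (unit_vec a x)"
proof -
  define z where "z = point_mass a x"
  define f where "f = (\<lambda>\<gamma>::'g. if \<gamma> = 0 then unit_vec a x else (\<lambda>i. 0))"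
  define g where "g = S_E E \<theta> Q (coboundary E \<phi> z)"
  define S where "S = insert 0 ((\<lambda>c. - gain Q c) ` E\<^sub>0)"
  have f: "twist \<tau> (S_V V \<theta> Q z) = f"
    unfolding z_def S_V_point_mass[OF a] f_def by (rule twist_supported_at_zero) simp
  have "(z, coboundary E \<phi> z) \<in> graph_on (ell2 V) (coboundary E \<phi>)"
    using point_mass_ell2[OF a] by (auto simp: graph_on_def z_def)
  then have "(z, coboundary E \<phi> z) \<in>
      graph_on (ell2 V) (S_V V \<theta> Q) O graph_on (ell2_vecs V\<^sub>0) (twist \<tau>) O fourier \<mu> V\<^sub>0 O
      graph_on (L2_vecs \<mu> V\<^sub>0) (multiplication \<Phi>) O (fourier \<mu> E\<^sub>0)\<inverse> O
      (graph_on (ell2 E) (S_E E \<theta> Q))\<inverse>"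
    using symbol by (simp only: is_symbol_function_def)
  then obtain h where fh: "(f, h) \<in> fourier \<mu> V\<^sub>0" and g\<Phi>: "(g, multiplication \<Phi> h) \<in> fourier \<mu> E\<^sub>0"
    by (auto simp: graph_on_def g_def f)
  have S: "finite S" "0 \<in> S" "\<And>c. c \<in> E\<^sub>0 \<Longrightarrow> - gain Q c \<in> S"
    using finite_orbits by (auto simp: S_def)
  have "g \<gamma> = (\<lambda>c. 0)" if "\<gamma> \<notin> S" for \<gamma>
  proof
    fix c
    show "g \<gamma> c = 0"
    proof (cases "c \<in> E\<^sub>0")
      case True
      then show ?thesis using that S(2) S(3)[OF True]
        by (auto simp: g_def z_def coboundary_point_mass[OF a True])
    qed (simp add: g_def S_E_def)
  qed
  then have "AE \<xi> in \<mu>. \<Phi> \<xi> (h \<xi>) = (\<lambda>c. \<Sum>\<gamma>\<in>S. cnj (\<xi> \<gamma>) *\<^sub>C g \<gamma> c)"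
    using fourier_finite_support[OF haar finite_orbits(2) g\<Phi> S(1)] by (simp add: multiplication_def)
  moreover have "AE \<xi> in \<mu>. h \<xi> = (\<lambda>i. \<Sum>\<gamma>\<in>{0}. cnj (\<xi> \<gamma>) *\<^sub>C f \<gamma> i)"
    by (rule fourier_finite_support[OF haar finite_orbits(1) fh]) (auto simp: f_def)
  ultimately show ?thesis
  proof (rule AE_mp[OF AE_conjI], intro AE_I2 impI)
    fix \<xi>
    assume "\<xi> \<in> space \<mu>" and *: "\<Phi> \<xi> (h \<xi>) = (\<lambda>c. \<Sum>\<gamma>\<in>S. cnj (\<xi> \<gamma>) *\<^sub>C g \<gamma> c) \<and>
      h \<xi> = (\<lambda>i. \<Sum>\<gamma>\<in>{0}. cnj (\<xi> \<gamma>) *\<^sub>C f \<gamma> i)"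
    then have \<xi>: "\<xi> \<in> dual_group" by (simp add: space_haar[OF haar])
    have h: "h \<xi> = unit_vec a x"
      using *[THEN conjunct2] by (simp add: f_def character_zero[OF \<xi>] scaleC_one)
    show "\<Phi> \<xi> (unit_vec a x) = orbit_operator V E \<phi> \<theta> Q \<xi> (unit_vec a x)"
      using *[THEN conjunct1, unfolded h] transform_point_mass[OF a \<xi> S, of x]
      by (simp only: g_def z_def)
  qed
qed

end

section \<open>The symbol function is the orbit matrix\<close>

theorem theorem3p7:
  fixes V :: "'v set" and E :: "'v set set"
    and \<phi> :: "'v \<Rightarrow> 'v \<Rightarrow> 'x::fd_complex_hilbert \<Rightarrow> 'y::fd_complex_hilbert"
    and \<theta> :: "'g::ab_group_add \<Rightarrow> 'v \<Rightarrow> 'v"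
    and \<tau> :: "'g \<Rightarrow> 'x \<Rightarrow> 'x"
    and Q :: "('v, 'g) gain_graph"
    and \<mu> :: "('g \<Rightarrow> complex) measure"
    and \<Phi> :: "('g \<Rightarrow> complex) \<Rightarrow> ('v set \<Rightarrow> 'x) \<Rightarrow> 'v set set \<Rightarrow> 'y"
  assumes "symmetric_framework V E \<phi> \<theta> \<tau>"
    and "is_gain_graph V E \<theta> Q"
    and "haar_prob_measure \<mu>"
    and "is_symbol_function \<mu> V E \<phi> \<theta> \<tau> Q \<Phi>"
  shows "AE \<xi> in \<mu>. \<forall>x\<in>vecs (vertex_orbits V \<theta>). \<Phi> \<xi> x = orbit_operator V E \<phi> \<theta> Q \<xi> x"
proof -
  interpret framework_with_gains V E \<phi> \<theta> \<tau> Q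
    using assms(1,2) by unfold_locales
  obtain B :: "'x set" where B: "finite B" and span: "\<And>x. \<exists>c. x = (\<Sum>b\<in>B. c b *\<^sub>C b)"
    using finite_dimensional by blast
  have "AE \<xi> in \<mu>. \<forall>a\<in>V\<^sub>0. \<forall>b\<in>B.
      \<Phi> \<xi> (unit_vec a b) = orbit_operator V E \<phi> \<theta> Q \<xi> (unit_vec a b)"
    using finite_orbits(1) B symbol_unit_vec[OF assms(3,4)] by (intro AE_finite_allI) auto
  then show ?thesis
  proof (rule AE_mp, intro AE_I2 impI ballI)
    fix \<xi> and x :: "'v set \<Rightarrow> 'x"
    assume "\<xi> \<in> space \<mu>" and x: "x \<in> vecs V\<^sub>0"
      and basis: "\<forall>a\<in>V\<^sub>0. \<forall>b\<in>B.
        \<Phi> \<xi> (unit_vec a b) = orbit_operator V E \<phi> \<theta> Q \<xi> (unit_vec a b)"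
    then have \<xi>: "\<xi> \<in> dual_group" by (simp add: space_haar[OF assms(3)])
    have \<Phi>_add: "\<Phi> \<xi> (\<lambda>i. x i + y i) = (\<lambda>j. \<Phi> \<xi> x j + \<Phi> \<xi> y j)"
      if "x \<in> vecs V\<^sub>0" "y \<in> vecs V\<^sub>0" for x y
      using assms(4) \<xi> that by (simp add: is_symbol_function_def Linf_ops_def)
    have \<Phi>_scale: "\<Phi> \<xi> (\<lambda>i. s *\<^sub>C x i) = (\<lambda>j. s *\<^sub>C \<Phi> \<xi> x j)" if "x \<in> vecs V\<^sub>0" for s x
      using assms(4) \<xi> that by (simp add: is_symbol_function_def Linf_ops_def)
    show "\<Phi> \<xi> x = orbit_operator V E \<phi> \<theta> Q \<xi> x"
      using finite_orbits(1) span x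
    proof (induction x rule: vecs_span_induct)
      case zero
      have "(\<lambda>i. 0) \<in> vecs V\<^sub>0" by (simp add: vecs_def)
      from \<Phi>_scale[OF this, of 0] orbit_operator_scale[of \<xi> 0 "\<lambda>i. 0"] show ?case
        by (simp add: scaleC_zero_left)
    qed (simp_all add: \<Phi>_add \<Phi>_scale orbit_operator_add orbit_operator_scale basis)
  qed
qed

end
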